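(* Let $F$ be a field of characteristic $0$, let $L$ be a finite-dimensional simple anti-commutative algebra over $F$ with product $[\cdot,\cdot]$, and let $r=\sum_i a_i\otimes b_i\in L\otimes L$ be a non skew-symmetric solution of the classical Yang-Baxter equation on $L$ such that $r+\tau(r)$ is $L$-invariant. Then there is a non-degenerate symmetric associative bilinear form $\omega$ on $L$ such that the operator $R:L\to L$ defined by $$R(a)=\sum_i \omega(a_i,a)\,b_i\qquad (a\in L)$$ is a Rota-Baxter operator on $L$ of non-zero weight.
   Context: Algebras are not assumed associative or unital. An algebra is simple if its product is not identically zero and it has no two-sided ideals other than $0$ and itself. An algebra is anti-commutative if $[x,y]=-[y,x]$ for all $x,y$. $\tau:L\otimes L\to L\otimes L$ is the linear switch map $\tau(x\otimes y)=y\otimes x$. An element $r\in L\otimes L$ is skew-symmetric if $\tau(r)=-r$; non skew-symmetric means $\tau(r)\neq -r$. An element $r=\sum_i a_i\otimes b_i\in L\otimes L$ is a solution of the classical Yang-Baxter equation on $L$ if in $L\otimes L\otimes L$ $$\sum_{i,j}\Big([a_i,a_j]\otimes b_i\otimes b_j-a_i\otimes[a_j,b_i]\otimes b_j+a_i\otimes a_j\otimes[b_i,b_j]\Big)=0.$$ An element $u=\sum_i u_i\otimes v_i\in L\otimes L$ is $L$-invariant if $\sum_i\big([u_i,a]\otimes v_i+u_i\otimes[v_i,a]\big)=0$ for all $a\in L$. A bilinear form $\omega$ on $L$ is associative if $\omega([x,y],z)=\omega(x,[y,z])$ for all $x,y,z\in L$. For $\lambda\in F$, a linear operator $R:L\to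 L$ is a Rota-Baxter operator of weight $\lambda$ if $[R(x),R(y)]=R([R(x),y]+[x,R(y)]+\lambda[x,y])$ for all $x,y\in L$. *)

theory Defs
  imports Complex_Main "HOL-Library.Poly_Mapping"
begin

section \<open>Algebras that need not be associative or unital\<close>

locale nonassoc_algebra = vector_space scale
  for scale :: "'f::field \<Rightarrow> 'l::ab_group_add \<Rightarrow> 'l" +
  fixes br :: "'l \<Rightarrow> 'l \<Rightarrow> 'l"
  assumes linear_left: "Vector_Spaces.linear scale scale (\<lambda>x. br x y)"
    and linear_right: "Vector_Spaces.linear scale scale (br x)"

definition two_sided_ideal ::
  "('f::field \<Rightarrow> 'l::ab_group_add \<Rightarrow> 'l) \<Rightarrow> ('l \<Rightarrow> 'l \<Rightarrow> 'l) \<Rightarrow> 'l set \<Rightarrow> bool"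
  where "two_sided_ideal scale br I \<longleftrightarrow>
    module.subspace scale I \<and> (\<forall>x\<in>I. \<forall>y. br x y \<in> I \<and> br y x \<in> I)"

definition simple_algebra ::
  "('f::field \<Rightarrow> 'l::ab_group_add \<Rightarrow> 'l) \<Rightarrow> ('l \<Rightarrow> 'l \<Rightarrow> 'l) \<Rightarrow> bool"
  where "simple_algebra scale br \<longleftrightarrow>
    (\<exists>x y. br x y \<noteq> 0) \<and> (\<forall>I. two_sided_ideal scale br I \<longrightarrow> I = {0} \<or> I = UNIV)"

definition anticommutative :: "('l::ab_group_add \<Rightarrow> 'l \<Rightarrow> 'l) \<Rightarrow> bool"
  where "anticommutative br \<longleftrightarrow> (\<forall>x y. br x y = - br y x)"


section \<open>Bilinear forms and Rota-Baxter operators\<close>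

definition bilinear_form ::
  "('f::field \<Rightarrow> 'l::ab_group_add \<Rightarrow> 'l) \<Rightarrow> ('l \<Rightarrow> 'l \<Rightarrow> 'f) \<Rightarrow> bool"
  where "bilinear_form scale \<omega> \<longleftrightarrow>
    (\<forall>y. Vector_Spaces.linear scale (*) (\<lambda>x. \<omega> x y)) \<and>
    (\<forall>x. Vector_Spaces.linear scale (*) (\<omega> x))"

definition nondegenerate_form :: "('l::ab_group_add \<Rightarrow> 'l \<Rightarrow> 'f::field) \<Rightarrow> bool"
  where "nondegenerate_form \<omega> \<longleftrightarrow>
    (\<forall>x. (\<forall>y. \<omega> x y = 0) \<longrightarrow> x = 0) \<and> (\<forall>y. (\<forall>x. \<omega> x y = 0) \<longrightarrow> y = 0)"

definition symmetric_form :: "('l \<Rightarrow> 'l \<Rightarrow> 'f) \<Rightarrow> bool"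
  where "symmetric_form \<omega> \<longleftrightarrow> (\<forall>x y. \<omega> x y = \<omega> y x)"

definition associative_form :: "('l \<Rightarrow> 'l \<Rightarrow> 'l) \<Rightarrow> ('l \<Rightarrow> 'l \<Rightarrow> 'f) \<Rightarrow> bool"
  where "associative_form br \<omega> \<longleftrightarrow> (\<forall>x y z. \<omega> (br x y) z = \<omega> x (br y z))"

definition rota_baxter ::
  "('f::field \<Rightarrow> 'l::ab_group_add \<Rightarrow> 'l) \<Rightarrow> ('l \<Rightarrow> 'l \<Rightarrow> 'l) \<Rightarrow> 'f \<Rightarrow> ('l \<Rightarrow> 'l) \<Rightarrow> bool"
  where "rota_baxter scale br \<mu> R \<longleftrightarrow>
    Vector_Spaces.linear scale scale R \<and>
    (\<forall>x y. br (R x) (R y) = R (br (R x) y + br x (R y) + scale \<mu> (br x y)))"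


section \<open>Free vector spaces\<close>

text \<open>The vector space with basis a type \<open>'k\<close> consists of the finitely supported functions
  \<open>'k \<Rightarrow>\<^sub>0 'f\<close>; the basis vector of \<open>k\<close> is \<open>Poly_Mapping.single k 1\<close>.\<close>

definition free_scale :: "'f::field \<Rightarrow> ('k \<Rightarrow>\<^sub>0 'f) \<Rightarrow> ('k \<Rightarrow>\<^sub>0 'f)"
  where "free_scale c = Poly_Mapping.map ((*) c)"

lemma lookup_free_scale [simp]:
  "Poly_Mapping.lookup (free_scale c p) k = c * Poly_Mapping.lookup p k"
  unfolding free_scale_def by transfer (simp add: when_def)

interpretation free: vector_space free_scale
  by standard (auto intro!: poly_mapping_eqI simp: lookup_add algebra_simps)

text \<open>\<open>lin_ext f\<close> is the linear map that sends the basis vector of \<open>k\<close> to \<open>f k\<close>.\<close>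

definition lin_ext :: "('k \<Rightarrow> ('m \<Rightarrow>\<^sub>0 'f)) \<Rightarrow> ('k \<Rightarrow>\<^sub>0 'f::field) \<Rightarrow> ('m \<Rightarrow>\<^sub>0 'f)"
  where "lin_ext f p =
    (\<Sum>k\<in>Poly_Mapping.keys p. free_scale (Poly_Mapping.lookup p k) (f k))"

lemma lin_ext_superset:
  assumes "finite K" "Poly_Mapping.keys p \<subseteq> K"
  shows "lin_ext f p = (\<Sum>k\<in>K. free_scale (Poly_Mapping.lookup p k) (f k))"
  unfolding lin_ext_def
  by (rule sum.mono_neutral_left) (use assms in \<open>auto simp: in_keys_iff\<close>)

lemma lin_ext_single [simp]: "lin_ext f (Poly_Mapping.single k c) = free_scale c (f k)"
  by (subst lin_ext_superset[of "{k}"]) auto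

lemma lin_ext_add: "lin_ext f (p + q) = lin_ext f p + lin_ext f q"
proof -
  let ?K = "Poly_Mapping.keys p \<union> Poly_Mapping.keys q"
  have "Poly_Mapping.keys (p + q) \<subseteq> ?K" by (rule keys_add)
  then show ?thesis
    by (simp add: lin_ext_superset[of ?K] lookup_add free.scale_left_distrib sum.distrib)
qed

lemma lin_ext_scale: "lin_ext f (free_scale c p) = free_scale c (lin_ext f p)"
proof -
  have "Poly_Mapping.keys (free_scale c p) \<subseteq> Poly_Mapping.keys p"
    by (auto simp: in_keys_iff)
  then show ?thesis
    by (simp add: lin_ext_superset[of "Poly_Mapping.keys p"] free.scale_sum_right)
qed

lemma linear_lin_ext: "Vector_Spaces.linear free_scale free_scale (lin_ext f)"
  unfolding Vector_Spaces.linear_iff by (auto simp: lin_ext_add lin_ext_scale free.vector_space_axioms)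

lemma lin_ext_zero [simp]: "lin_ext f 0 = 0"
  by (simp add: lin_ext_def)

lemma lin_ext_diff: "lin_ext f (p - q) = lin_ext f p - lin_ext f q"
  by (metis add_diff_cancel diff_add_cancel lin_ext_add)

lemma lin_ext_sum: "lin_ext f (\<Sum>i\<in>A. p i) = (\<Sum>i\<in>A. lin_ext f (p i))"
  by (induction A rule: infinite_finite_induct) (auto simp: lin_ext_add)

lemma lin_ext_fun_diff: "lin_ext (\<lambda>k. f k - g k) p = lin_ext f p - lin_ext g p"
  by (simp add: lin_ext_def free.scale_right_diff_distrib sum_subtractf)

lemma lin_ext_swap:
  "lin_ext (\<lambda>k. lin_ext (h k) s) r = lin_ext (\<lambda>l. lin_ext (\<lambda>k. h k l) r) s"
  unfolding lin_ext_def free.scale_sum_right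
  by (subst sum.swap) (simp add: mult.commute)


section \<open>Tensors\<close>

text \<open>
  \<open>L \<otimes> L\<close> is the quotient of the free vector space on \<open>L \<times> L\<close> by the span of the relations
  that make \<open>\<otimes>\<close> bilinear, and similarly for \<open>L \<otimes> L \<otimes> L\<close> and \<open>L \<times> L \<times> L\<close>.
  The relations involve the scalar multiplication of \<open>L\<close>, which is a term, so the quotients are
  not types: a tensor is given by a representative in the free vector space, and
  \<open>tensor2_eq\<close>, \<open>tensor3_eq\<close> are equality in the quotients.  The operations on \<open>L \<otimes> L\<close>
  below are shown to respect these equalities.
\<close>

definition tens2 :: "'l \<Rightarrow> 'l \<Rightarrow> ('l \<times> 'l \<Rightarrow>\<^sub>0 'f::field)"
  where "tens2 x y = Poly_Mapping.single (x, y) 1"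

definition tens3 :: "'l \<Rightarrow> 'l \<Rightarrow> 'l \<Rightarrow> ('l \<times> 'l \<times> 'l \<Rightarrow>\<^sub>0 'f::field)"
  where "tens3 x y z = Poly_Mapping.single (x, y, z) 1"

inductive_set tensor2_relations ::
  "('f::field \<Rightarrow> 'l::ab_group_add \<Rightarrow> 'l) \<Rightarrow> ('l \<times> 'l \<Rightarrow>\<^sub>0 'f) set"
  for scale where
  "tens2 (x + x') y - (tens2 x y + tens2 x' y) \<in> tensor2_relations scale"
| "tens2 x (y + y') - (tens2 x y + tens2 x y') \<in> tensor2_relations scale"
| "tens2 (scale c x) y - free_scale c (tens2 x y) \<in> tensor2_relations scale"
| "tens2 x (scale c y) - free_scale c (tens2 x y) \<in> tensor2_relations scale"

inductive_set tensor3_relations ::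
  "('f::field \<Rightarrow> 'l::ab_group_add \<Rightarrow> 'l) \<Rightarrow> ('l \<times> 'l \<times> 'l \<Rightarrow>\<^sub>0 'f) set"
  for scale where
  "tens3 (x + x') y z - (tens3 x y z + tens3 x' y z) \<in> tensor3_relations scale"
| "tens3 x (y + y') z - (tens3 x y z + tens3 x y' z) \<in> tensor3_relations scale"
| "tens3 x y (z + z') - (tens3 x y z + tens3 x y z') \<in> tensor3_relations scale"
| "tens3 (scale c x) y z - free_scale c (tens3 x y z) \<in> tensor3_relations scale"
| "tens3 x (scale c y) z - free_scale c (tens3 x y z) \<in> tensor3_relations scale"
| "tens3 x y (scale c z) - free_scale c (tens3 x y z) \<in> tensor3_relations scale"

definition tensor2_eq ::
  "('f::field \<Rightarrow> 'l::ab_group_add \<Rightarrow> 'l) \<Rightarrow> ('l \<times> 'l \<Rightarrow>\<^sub>0 'f) \<Rightarrow> ('l \<times> 'l \<Rightarrow>\<^sub>0 'f) \<Rightarrow> bool"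
  where "tensor2_eq scale p q \<longleftrightarrow> p - q \<in> free.span (tensor2_relations scale)"

definition tensor3_eq ::
  "('f::field \<Rightarrow> 'l::ab_group_add \<Rightarrow> 'l)
    \<Rightarrow> ('l \<times> 'l \<times> 'l \<Rightarrow>\<^sub>0 'f) \<Rightarrow> ('l \<times> 'l \<times> 'l \<Rightarrow>\<^sub>0 'f) \<Rightarrow> bool"
  where "tensor3_eq scale p q \<longleftrightarrow> p - q \<in> free.span (tensor3_relations scale)"

definition tensor_switch :: "('l \<times> 'l \<Rightarrow>\<^sub>0 'f::field) \<Rightarrow> ('l \<times> 'l \<Rightarrow>\<^sub>0 'f)"
  where "tensor_switch = lin_ext (\<lambda>(x, y). tens2 y x)"

definition skew_symmetric_tensor ::
  "('f::field \<Rightarrow> 'l::ab_group_add \<Rightarrow> 'l) \<Rightarrow> ('l \<times> 'l \<Rightarrow>\<^sub>0 'f) \<Rightarrow> bool"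
  where "skew_symmetric_tensor scale r \<longleftrightarrow> tensor2_eq scale (tensor_switch r) (- r)"

definition tensor_action ::
  "('l \<Rightarrow> 'l \<Rightarrow> 'l) \<Rightarrow> 'l \<Rightarrow> ('l \<times> 'l \<Rightarrow>\<^sub>0 'f::field) \<Rightarrow> ('l \<times> 'l \<Rightarrow>\<^sub>0 'f)"
  where "tensor_action br a = lin_ext (\<lambda>(x, y). tens2 (br x a) y + tens2 x (br y a))"

definition invariant_tensor ::
  "('f::field \<Rightarrow> 'l::ab_group_add \<Rightarrow> 'l) \<Rightarrow> ('l \<Rightarrow> 'l \<Rightarrow> 'l) \<Rightarrow> ('l \<times> 'l \<Rightarrow>\<^sub>0 'f) \<Rightarrow> bool"
  where "invariant_tensor scale br u \<longleftrightarrow> (\<forall>a. tensor2_eq scale (tensor_action br a u) 0)"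

text \<open>In \<open>cybe_term\<close> the pairs are \<open>(a\<^sub>i, b\<^sub>i)\<close> and \<open>(a\<^sub>j, b\<^sub>j)\<close>.  The left-hand side of the
  classical Yang-Baxter equation is quadratic in \<open>r\<close>, so it is the diagonal of a bilinear map;
  lemma \<open>cybe_lhs_sum\<close> below gives the double sum for \<open>r = (\<Sum>i. a\<^sub>i \<otimes> b\<^sub>i)\<close>.\<close>

definition cybe_term ::
  "('l \<Rightarrow> 'l \<Rightarrow> 'l) \<Rightarrow> 'l \<times> 'l \<Rightarrow> 'l \<times> 'l \<Rightarrow> ('l \<times> 'l \<times> 'l \<Rightarrow>\<^sub>0 'f::field)"
  where "cybe_term br = (\<lambda>(a, b) (a', b').
    tens3 (br a a') b b' - tens3 a (br a' b) b' + tens3 a a' (br b b'))"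

definition cybe_bilinear :: "('l \<Rightarrow> 'l \<Rightarrow> 'l)
    \<Rightarrow> ('l \<times> 'l \<Rightarrow>\<^sub>0 'f::field) \<Rightarrow> ('l \<times> 'l \<Rightarrow>\<^sub>0 'f) \<Rightarrow> ('l \<times> 'l \<times> 'l \<Rightarrow>\<^sub>0 'f)"
  where "cybe_bilinear br r s = lin_ext (\<lambda>k. lin_ext (cybe_term br k) s) r"

definition cybe_solution ::
  "('f::field \<Rightarrow> 'l::ab_group_add \<Rightarrow> 'l) \<Rightarrow> ('l \<Rightarrow> 'l \<Rightarrow> 'l) \<Rightarrow> ('l \<times> 'l \<Rightarrow>\<^sub>0 'f) \<Rightarrow> bool"
  where "cybe_solution scale br r \<longleftrightarrow> tensor3_eq scale (cybe_bilinear br r r) 0"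


subsection \<open>Values on sums of pure tensors\<close>

lemma tensor_switch_sum:
  "tensor_switch (\<Sum>i\<in>A. tens2 (a i) (b i)) = (\<Sum>i\<in>A. tens2 (b i) (a i))"
  by (simp add: tensor_switch_def lin_ext_sum tens2_def)

lemma tensor_action_sum:
  "tensor_action br x (\<Sum>i\<in>A. tens2 (a i) (b i)) =
    (\<Sum>i\<in>A. tens2 (br (a i) x) (b i) + tens2 (a i) (br (b i) x))"
  by (simp add: tensor_action_def lin_ext_sum tens2_def)

lemma cybe_lhs_sum:
  fixes a b :: "'i \<Rightarrow> 'l" and A :: "'i set"
  defines "r \<equiv> (\<Sum>i\<in>A. tens2 (a i) (b i))"
  shows "cybe_bilinear br r r = (\<Sum>i\<in>A. \<Sum>j\<in>A.
    tens3 (br (a i) (a j)) (b i) (b j) - tens3 (a i) (br (a j) (b i)) (b j)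
      + tens3 (a i) (a j) (br (b i) (b j)))"
  by (simp add: r_def cybe_bilinear_def lin_ext_sum tens2_def cybe_term_def)


subsection \<open>Compatibility with equality of tensors\<close>

context
  fixes scale :: "'f::field \<Rightarrow> 'l::ab_group_add \<Rightarrow> 'l"
begin

lemmas tens2_rel = tensor2_relations.intros[where scale = scale, THEN free.span_base]
lemmas tens3_rel = tensor3_relations.intros[where scale = scale, THEN free.span_base]

lemma lin_ext_in_span:
  assumes "\<And>k. f k \<in> free.span T"
  shows "lin_ext f p \<in> free.span T"
  unfolding lin_ext_def by (intro free.span_sum free.span_scale assms)

text \<open>\<open>bilinear_mod T f\<close>: \<open>f\<close> is bilinear modulo the span of \<open>T\<close>.\<close>

definition bilinear_mod :: "('m \<Rightarrow>\<^sub>0 'f) set \<Rightarrow> ('l \<times> 'l \<Rightarrow> ('m \<Rightarrow>\<^sub>0 'f)) \<Rightarrow> bool"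
  where "bilinear_mod T f \<longleftrightarrow>
    (\<forall>x x' y. f (x + x', y) - (f (x, y) + f (x', y)) \<in> free.span T) \<and>
    (\<forall>x y y'. f (x, y + y') - (f (x, y) + f (x, y')) \<in> free.span T) \<and>
    (\<forall>c x y. f (scale c x, y) - free_scale c (f (x, y)) \<in> free.span T) \<and>
    (\<forall>c x y. f (x, scale c y) - free_scale c (f (x, y)) \<in> free.span T)"

lemma bilinear_mod_add:
  assumes "bilinear_mod T f" "bilinear_mod T g"
  shows "bilinear_mod T (\<lambda>k. f k + g k)"
proof -
  have *: "(a + b) - ((c + d) + (c' + d')) = (a - (c + c')) + (b - (d + d'))"
    "(a + b) - free_scale e (c + d) = (a - free_scale e c) + (b - free_scale e d)"
    for a b c d c' d' :: "'m \<Rightarrow>\<^sub>0 'f" and e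
    by (simp_all add: algebra_simps free.scale_right_distrib)
  show ?thesis
    unfolding bilinear_mod_def *
    by (intro conjI allI free.span_add) (use assms in \<open>simp_all add: bilinear_mod_def\<close>)
qed

lemma bilinear_mod_uminus:
  assumes "bilinear_mod T f"
  shows "bilinear_mod T (\<lambda>k. - f k)"
proof -
  have *: "- a - (- b + - c) = - (a - (b + c))"
    "- a - free_scale e (- b) = - (a - free_scale e b)"
    for a b c :: "'m \<Rightarrow>\<^sub>0 'f" and e
    by (simp_all add: algebra_simps)
  show ?thesis
    unfolding bilinear_mod_def *
    by (intro conjI allI free.span_neg) (use assms in \<open>simp_all add: bilinear_mod_def\<close>)
qed

lemma bilinear_mod_diff:
  assumes "bilinear_mod T f" "bilinear_mod T g"
  shows "bilinear_mod T (\<lambda>k. f k - g k)"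
  using bilinear_mod_add[OF assms(1) bilinear_mod_uminus[OF assms(2)]] by simp

lemma lin_ext_bilinear_mod:
  assumes "bilinear_mod T f" and p: "p \<in> free.span (tensor2_relations scale)"
  shows "lin_ext f p \<in> free.span T"
  using p
proof (induction rule: free.span_induct_alt)
  case base
  then show ?case by (simp add: free.span_zero)
next
  case (step c g q)
  from step(1) have "lin_ext f g \<in> free.span T"
    by cases (use assms(1) in
      \<open>simp_all add: bilinear_mod_def lin_ext_diff lin_ext_add lin_ext_scale tens2_def\<close>)
  with step(2) show ?case
    by (simp add: lin_ext_add lin_ext_scale free.span_add free.span_scale)
qed

lemma tensor_switch_respects:
  assumes "tensor2_eq scale p q"
  shows "tensor2_eq scale (tensor_switch p) (tensor_switch q)"
proof -
  have "bilinear_mod (tensor2_relations scale) (\<lambda>(x, y). tens2 y x)"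
    unfolding bilinear_mod_def by (simp add: tens2_rel)
  from lin_ext_bilinear_mod[OF this] assms show ?thesis
    by (simp add: tensor2_eq_def tensor_switch_def flip: lin_ext_diff)
qed

lemma tensor_action_respects:
  assumes "nonassoc_algebra scale br" "tensor2_eq scale p q"
  shows "tensor2_eq scale (tensor_action br a p) (tensor_action br a q)"
proof -
  interpret nonassoc_algebra scale br by fact
  have [simp]: "br (x + y) z = br x z + br y z" "br (scale c x) z = scale c (br x z)" for x y z c
    using linear_left[of z] by (simp_all add: Vector_Spaces.linear_iff)
  have "bilinear_mod (tensor2_relations scale) (\<lambda>k. tens2 (br (fst k) a) (snd k))"
    "bilinear_mod (tensor2_relations scale) (\<lambda>k. tens2 (fst k) (br (snd k) a))"
    unfolding bilinear_mod_def by (simp_all add: tens2_rel)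
  from lin_ext_bilinear_mod[OF bilinear_mod_add[OF this]] assms(2) show ?thesis
    by (simp add: tensor2_eq_def tensor_action_def case_prod_unfold flip: lin_ext_diff)
qed

lemma cybe_bilinear_respects:
  assumes "nonassoc_algebra scale br" "tensor2_eq scale p q"
  shows "tensor3_eq scale (cybe_bilinear br p p) (cybe_bilinear br q q)"
proof -
  interpret nonassoc_algebra scale br by fact
  let ?N = "free.span (tensor3_relations scale)"
  have [simp]: "br (x + y) z = br x z + br y z" "br (scale c x) z = scale c (br x z)"
    "br z (x + y) = br z x + br z y" "br z (scale c x) = scale c (br z x)" for x y z c
    using linear_left[of z] linear_right[of z] by (simp_all add: Vector_Spaces.linear_iff)
  have "bilinear_mod (tensor3_relations scale) (\<lambda>k. tens3 (br (fst l) (fst k)) (snd l) (snd k))"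
    "bilinear_mod (tensor3_relations scale) (\<lambda>k. tens3 (fst l) (br (fst k) (snd l)) (snd k))"
    "bilinear_mod (tensor3_relations scale) (\<lambda>k. tens3 (fst l) (fst k) (br (snd l) (snd k)))"
    for l :: "'l \<times> 'l"
    unfolding bilinear_mod_def by (simp_all add: tens3_rel)
  then have right: "bilinear_mod (tensor3_relations scale) (cybe_term br l)" for l
    unfolding cybe_term_def case_prod_unfold by (intro bilinear_mod_add bilinear_mod_diff)
  have "bilinear_mod (tensor3_relations scale) (\<lambda>l. tens3 (br (fst l) (fst k)) (snd l) (snd k))"
    "bilinear_mod (tensor3_relations scale) (\<lambda>l. tens3 (fst l) (br (fst k) (snd l)) (snd k))"
    "bilinear_mod (tensor3_relations scale) (\<lambda>l. tens3 (fst l) (fst k) (br (snd l) (snd k)))"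
    for k :: "'l \<times> 'l"
    unfolding bilinear_mod_def by (simp_all add: tens3_rel)
  then have left: "bilinear_mod (tensor3_relations scale) (\<lambda>l. cybe_term br l k)" for k
    unfolding cybe_term_def case_prod_unfold by (intro bilinear_mod_add bilinear_mod_diff)
  have pq: "p - q \<in> free.span (tensor2_relations scale)"
    using assms(2) by (simp add: tensor2_eq_def)
  have "cybe_bilinear br p (p - q) \<in> ?N"
    unfolding cybe_bilinear_def by (intro lin_ext_in_span lin_ext_bilinear_mod[OF right pq])
  moreover have "cybe_bilinear br (p - q) q \<in> ?N"
    unfolding cybe_bilinear_def
    by (subst lin_ext_swap) (intro lin_ext_in_span lin_ext_bilinear_mod[OF left pq])
  moreover have "cybe_bilinear br p p - cybe_bilinear br q q =
    cybe_bilinear br p (p - q) + cybe_bilinear br (p - q) q"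
    unfolding cybe_bilinear_def
    by (simp add: lin_ext_diff lin_ext_fun_diff)
  ultimately show ?thesis
    by (simp add: tensor3_eq_def free.span_add)
qed

end

end

theory Submission
  imports Defs
begin

text \<open>
  Write \<open>u = r + \<tau>(r)\<close>, a nonzero invariant symmetric tensor.  Contracting its first leg gives a
  linear map from functionals to vectors, \<open>f \<mapsto> \<Sum> f(u\<^sub>i) v\<^sub>i\<close>.  By invariance its image is an
  ideal, hence all of \<open>L\<close>; by symmetry of \<open>u\<close>, surjectivity implies injectivity.  The inverse map is
  the form \<open>\<omega>\<close>: it is symmetric because \<open>u\<close> is, and associative because \<open>u\<close> is invariant.  If \<open>R\<^sup>*\<close>
  is the \<open>\<omega>\<close>-adjoint of \<open>R\<close>, then \<open>R + R\<^sup>* = id\<close> because \<open>u\<close> is dual to \<open>\<omega>\<close>.  Contracting the first two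
  legs of the Yang-Baxter equation with \<open>x\<close> and \<open>y\<close> gives \<open>[R x, R y] = R([R x, y] + [R\<^sup>* y, x])\<close>,
  and substituting \<open>R\<^sup>* y = y - R y\<close> shows that \<open>R\<close> is Rota-Baxter of weight \<open>-1\<close>.
\<close>

section \<open>Linear extension to the algebra itself, and contraction of tensors\<close>

definition free_lift ::
  "('f::field \<Rightarrow> 'l::ab_group_add \<Rightarrow> 'l) \<Rightarrow> ('k \<Rightarrow> 'l) \<Rightarrow> ('k \<Rightarrow>\<^sub>0 'f) \<Rightarrow> 'l"
  where "free_lift scale g p =
    (\<Sum>k\<in>Poly_Mapping.keys p. scale (Poly_Mapping.lookup p k) (g k))"

text \<open>On representatives this is \<open>f\<close> tensored with the identity, followed by the
  identification of the tensor product of the field with the algebra and the algebra itself. It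
  descends to tensors once \<open>f\<close> is linear.\<close>

definition contract ::
  "('f::field \<Rightarrow> 'l::ab_group_add \<Rightarrow> 'l) \<Rightarrow> ('l \<Rightarrow> 'f) \<Rightarrow> ('l \<times> 'l \<Rightarrow>\<^sub>0 'f) \<Rightarrow> 'l"
  where "contract scale f = free_lift scale (\<lambda>(x, y). scale (f x) y)"

context vector_space
begin

lemma free_lift_superset:
  assumes "finite K" "Poly_Mapping.keys p \<subseteq> K"
  shows "free_lift scale g p = (\<Sum>k\<in>K. scale (Poly_Mapping.lookup p k) (g k))"
  unfolding free_lift_def
  by (rule sum.mono_neutral_left) (use assms in \<open>auto simp: in_keys_iff\<close>)

lemma free_lift_zero [simp]: "free_lift scale g 0 = 0"
  by (simp add: free_lift_def)

lemma free_lift_single [simp]: "free_lift scale g (Poly_Mapping.single k c) = scale c (g k)"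
  by (subst free_lift_superset[of "{k}"]) auto

lemma free_lift_add: "free_lift scale g (p + q) = free_lift scale g p + free_lift scale g q"
proof -
  let ?K = "Poly_Mapping.keys p \<union> Poly_Mapping.keys q"
  have "Poly_Mapping.keys (p + q) \<subseteq> ?K" by (rule keys_add)
  then show ?thesis
    by (simp add: free_lift_superset[of ?K] lookup_add scale_left_distrib sum.distrib)
qed

lemma free_lift_scale: "free_lift scale g (free_scale c p) = scale c (free_lift scale g p)"
proof -
  have "Poly_Mapping.keys (free_scale c p) \<subseteq> Poly_Mapping.keys p"
    by (auto simp: in_keys_iff)
  then show ?thesis
    by (simp add: free_lift_superset[of "Poly_Mapping.keys p"] scale_sum_right)
qed

lemma free_lift_diff: "free_lift scale g (p - q) = free_lift scale g p - free_lift scale g q"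
  by (metis add_diff_cancel diff_add_cancel free_lift_add)

lemma free_lift_sum: "free_lift scale g (\<Sum>i\<in>A. p i) = (\<Sum>i\<in>A. free_lift scale g (p i))"
  by (induction A rule: infinite_finite_induct) (auto simp: free_lift_add)

lemma free_lift_span_eq_zero:
  assumes "\<And>t. t \<in> T \<Longrightarrow> free_lift scale g t = 0" and "p \<in> free.span T"
  shows "free_lift scale g p = 0"
  using assms(2)
  by (induction rule: free.span_induct_alt) (simp_all add: assms(1) free_lift_add free_lift_scale)

lemma contract_tens2 [simp]: "contract scale f (tens2 x y) = scale (f x) y"
  by (simp add: contract_def tens2_def)

lemma contract_add: "contract scale f (p + q) = contract scale f p + contract scale f q"
  by (simp add: contract_def free_lift_add)

lemma contract_sum: "contract scale f (\<Sum>i\<in>A. p i) = (\<Sum>i\<in>A. contract scale f (p i))"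
  by (simp add: contract_def free_lift_sum)

text \<open>For linear \<open>f\<close> the map sending \<open>(x, y)\<close> to
  \<open>scale (f x) y\<close> is bilinear, so each defining relation of the tensor product is sent
  to zero, and hence so is their span.\<close>

lemma contract_respects:
  assumes f: "Vector_Spaces.linear scale (*) f" and "tensor2_eq scale p q"
  shows "contract scale f p = contract scale f q"
proof -
  have [simp]: "f (x + y) = f x + f y" "f (scale c x) = c * f x" for x y c
    using f by (simp_all add: Vector_Spaces.linear_iff)
  have *: "free_lift scale (\<lambda>(x, y). scale (f x) y) t = 0" if "t \<in> tensor2_relations scale" for t
    using that
    by cases (simp_all add: tens2_def free_lift_diff free_lift_add free_lift_scale
          scale_left_distrib scale_right_distrib distrib_left distrib_right ac_simps)
  have "contract scale f (p - q) = 0"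
    using assms(2) free_lift_span_eq_zero[OF *]
    unfolding contract_def tensor2_eq_def by blast
  then show ?thesis
    by (simp add: contract_def free_lift_diff)
qed

text \<open>The same argument for a trilinear map. It turns the Yang-Baxter equation, an identity
  between triple tensors, into identities between vectors.\<close>

lemma contract3_eq_zero:
  assumes f: "Vector_Spaces.linear scale (*) f" and g: "Vector_Spaces.linear scale (*) g"
    and "tensor3_eq scale p 0"
  shows "free_lift scale (\<lambda>(x, y, z). scale (f x * g y) z) p = 0"
proof -
  have [simp]: "f (x + y) = f x + f y" "f (scale c x) = c * f x"
    "g (x + y) = g x + g y" "g (scale c x) = c * g x" for x y c
    using f g by (simp_all add: Vector_Spaces.linear_iff)
  have "free_lift scale (\<lambda>(x, y, z). scale (f x * g y) z) t = 0"
    if "t \<in> tensor3_relations scale" for t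
    using that
    by cases (simp_all add: tens3_def free_lift_diff free_lift_add free_lift_scale
          scale_left_distrib scale_right_distrib distrib_left distrib_right ac_simps)
  from free_lift_span_eq_zero[OF this] assms(3) show ?thesis
    by (simp add: tensor3_eq_def)
qed

end

section \<open>Congruence laws and bilinearity for equality of tensors\<close>

lemma tensor2_eq_trans:
  "tensor2_eq scale p q \<Longrightarrow> tensor2_eq scale q s \<Longrightarrow> tensor2_eq scale p s"
  unfolding tensor2_eq_def using free.span_add[of "p - q" _ "q - s"] by simp

lemma tensor2_eq_sym: "tensor2_eq scale p q \<Longrightarrow> tensor2_eq scale q p"
  unfolding tensor2_eq_def using free.span_neg[of "p - q"] by simp

lemma tensor2_eq_add:
  "tensor2_eq scale p q \<Longrightarrow> tensor2_eq scale p' q' \<Longrightarrow> tensor2_eq scale (p + p') (q + q')"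
  unfolding tensor2_eq_def using free.span_add[of "p - q" _ "p' - q'"]
  by (simp add: algebra_simps)

lemma tensor2_eq_sum:
  "(\<And>i. i \<in> A \<Longrightarrow> tensor2_eq scale (p i) (q i)) \<Longrightarrow>
    tensor2_eq scale (\<Sum>i\<in>A. p i) (\<Sum>i\<in>A. q i)"
  unfolding tensor2_eq_def by (simp add: free.span_sum flip: sum_subtractf)

lemma tensor2_eq_scale:
  "tensor2_eq scale p q \<Longrightarrow> tensor2_eq scale (free_scale c p) (free_scale c q)"
  unfolding tensor2_eq_def using free.span_scale[of "p - q"]
  by (simp add: free.scale_right_diff_distrib)

context vector_space
begin

lemma tens2_zero_left: "tensor2_eq scale (tens2 0 y) 0"
  using tens2_rel(3)[where scale = scale and c = 0 and x = 0 and y = y] by (simp add: tensor2_eq_def)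

lemma tens2_zero_right: "tensor2_eq scale (tens2 x 0) 0"
  using tens2_rel(4)[where scale = scale and c = 0 and x = x and y = 0] by (simp add: tensor2_eq_def)

lemma tens2_sum_left: "tensor2_eq scale (tens2 (\<Sum>i\<in>A. x i) y) (\<Sum>i\<in>A. tens2 (x i) y)"
proof (induction A rule: infinite_finite_induct)
  case (insert j A)
  have "tensor2_eq scale (tens2 (x j + (\<Sum>i\<in>A. x i)) y) (tens2 (x j) y + tens2 (\<Sum>i\<in>A. x i) y)"
    by (simp add: tensor2_eq_def tens2_rel)
  moreover have "tensor2_eq scale (tens2 (x j) y + tens2 (\<Sum>i\<in>A. x i) y)
      (tens2 (x j) y + (\<Sum>i\<in>A. tens2 (x i) y))"
    using insert(3) by (simp add: tensor2_eq_def)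
  ultimately show ?case
    using insert by (auto intro: tensor2_eq_trans)
qed (simp_all add: tens2_zero_left)

lemma tens2_sum_right: "tensor2_eq scale (tens2 x (\<Sum>i\<in>A. y i)) (\<Sum>i\<in>A. tens2 x (y i))"
proof (induction A rule: infinite_finite_induct)
  case (insert j A)
  have "tensor2_eq scale (tens2 x (y j + (\<Sum>i\<in>A. y i))) (tens2 x (y j) + tens2 x (\<Sum>i\<in>A. y i))"
    by (simp add: tensor2_eq_def tens2_rel)
  moreover have "tensor2_eq scale (tens2 x (y j) + tens2 x (\<Sum>i\<in>A. y i))
      (tens2 x (y j) + (\<Sum>i\<in>A. tens2 x (y i)))"
    using insert(3) by (simp add: tensor2_eq_def)
  ultimately show ?case
    using insert by (auto intro: tensor2_eq_trans)
qed (simp_all add: tens2_zero_right)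

text \<open>Both sides equal \<open>d * c\<close> times the pure tensor. The form fits the expansion
  of a tensor in a basis: \<open>d\<close> will be a coefficient of the representative and
  \<open>c\<close> a coordinate of a first leg.\<close>

lemma tens2_scale_left_right:
  "tensor2_eq scale (free_scale d (tens2 (scale c x) y)) (tens2 x (scale (d * c) y))"
proof -
  have "tensor2_eq scale (tens2 (scale c x) y) (free_scale c (tens2 x y))"
    by (simp add: tensor2_eq_def tens2_rel)
  then have "tensor2_eq scale (free_scale d (tens2 (scale c x) y))
      (free_scale d (free_scale c (tens2 x y)))"
    by (rule tensor2_eq_scale)
  moreover have "tensor2_eq scale (tens2 x (scale (d * c) y)) (free_scale (d * c) (tens2 x y))"
    by (simp add: tensor2_eq_def tens2_rel)
  ultimately show ?thesis
    by (auto intro: tensor2_eq_trans tensor2_eq_sym)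
qed

end

section \<open>Functionals on the first leg detect non-zero tensors\<close>

context finite_dimensional_vector_space
begin

lemma linear_representation:
  "Vector_Spaces.linear scale (*) (\<lambda>x. representation Basis x c)"
  unfolding Vector_Spaces.linear_iff
  by (auto simp: vector_space_axioms representation_add representation_scale independent_Basis
      span_Basis vector_space_def algebra_simps)

text \<open>Expanding only the first legs in \<open>Basis\<close> brings \<open>p\<close> to the
  form of a sum over \<open>e\<close> of \<open>e\<close> \<otimes> \<open>w e\<close>. Here
  \<open>w e\<close> is the contraction of \<open>p\<close> with the coordinate functional of
  \<open>e\<close>, so it vanishes.\<close>

lemma tensor2_eq_zero_if_contract_eq_zero:
  assumes "\<And>f. Vector_Spaces.linear scale (*) f \<Longrightarrow> contract scale f p = 0"
  shows "tensor2_eq scale p 0"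
proof -
  let ?c = "\<lambda>k. Poly_Mapping.lookup p k"
  let ?rep = "\<lambda>k e. representation Basis (fst k) e"
  let ?K = "Poly_Mapping.keys p"
  have p: "p = (\<Sum>k\<in>?K. free_scale (?c k) (tens2 (fst k) (snd k)))"
    by (rule poly_mapping_eqI)
      (simp add: lookup_sum tens2_def lookup_single when_def sum.delta in_keys_iff if_distrib cong: if_cong)
  have expand: "tens2 (fst k) (snd k) = tens2 (\<Sum>e\<in>Basis. scale (?rep k e) e) (snd k)" for k
    by (subst sum_representation_eq) (auto simp: independent_Basis span_Basis finite_Basis)
  have step: "tensor2_eq scale (free_scale (?c k) (tens2 (fst k) (snd k)))
      (\<Sum>e\<in>Basis. tens2 e (scale (?c k * ?rep k e) (snd k)))" for k
  proof (rule tensor2_eq_trans)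
    show "tensor2_eq scale (free_scale (?c k) (tens2 (fst k) (snd k)))
        (free_scale (?c k) (\<Sum>e\<in>Basis. tens2 (scale (?rep k e) e) (snd k)))"
      unfolding expand by (intro tensor2_eq_scale tens2_sum_left)
    show "tensor2_eq scale (free_scale (?c k) (\<Sum>e\<in>Basis. tens2 (scale (?rep k e) e) (snd k)))
        (\<Sum>e\<in>Basis. tens2 e (scale (?c k * ?rep k e) (snd k)))"
      unfolding free.scale_sum_right by (intro tensor2_eq_sum tens2_scale_left_right)
  qed
  have "tensor2_eq scale p (\<Sum>k\<in>?K. \<Sum>e\<in>Basis. tens2 e (scale (?c k * ?rep k e) (snd k)))"
    by (subst p) (intro tensor2_eq_sum step)
  also have "(\<Sum>k\<in>?K. \<Sum>e\<in>Basis. tens2 e (scale (?c k * ?rep k e) (snd k))) =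
      (\<Sum>e\<in>Basis. \<Sum>k\<in>?K. tens2 e (scale (?c k * ?rep k e) (snd k)))"
    by (rule sum.swap)
  finally have "tensor2_eq scale p \<dots>" .
  moreover have "tensor2_eq scale (\<Sum>e\<in>Basis. \<Sum>k\<in>?K. tens2 e (scale (?c k * ?rep k e) (snd k)))
      (\<Sum>e\<in>Basis. tens2 e (\<Sum>k\<in>?K. scale (?c k * ?rep k e) (snd k)))"
    by (intro tensor2_eq_sum tensor2_eq_sym[OF tens2_sum_right])
  \<comment> \<open>This sum is the contraction of \<open>p\<close> with the coordinate functional
    of \<open>e\<close>.\<close>
  moreover have "(\<Sum>k\<in>?K. scale (?c k * ?rep k e) (snd k)) = 0" for e
    using assms[OF linear_representation, of e]
    by (simp add: contract_def free_lift_def case_prod_unfold)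
  moreover have "tensor2_eq scale (\<Sum>e\<in>Basis. tens2 e 0) (\<Sum>e\<in>Basis. 0)"
    by (intro tensor2_eq_sum tens2_zero_right)
  ultimately show ?thesis
    by (auto intro: tensor2_eq_trans)
qed

end

section \<open>The invariant form as inverse of a contraction map\<close>

context nonassoc_algebra
begin

lemma br_linear:
  "br (x + y) z = br x z + br y z" "br (scale c x) z = scale c (br x z)"
  "br z (x + y) = br z x + br z y" "br z (scale c x) = scale c (br z x)"
  using linear_left[of z] linear_right[of z] by (simp_all add: Vector_Spaces.linear_iff)

lemma br_zero [simp]: "br 0 z = 0" "br z 0 = 0"
  using br_linear(2)[of 0 0 z] br_linear(4)[of z 0 0] by simp_all

lemma br_uminus: "br (- x) z = - br x z" "br z (- x) = - br z x"
  using br_linear(2)[of "-1" x z] br_linear(4)[of z "-1" x] by simp_all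

lemma br_diff: "br (x - y) z = br x z - br y z" "br z (x - y) = br z x - br z y"
  using br_linear(1)[of x "- y"] br_linear(3)[of z x "- y"] by (simp_all add: br_uminus)

lemma br_sum: "br (\<Sum>i\<in>A. x i) z = (\<Sum>i\<in>A. br (x i) z)" "br z (\<Sum>i\<in>A. x i) = (\<Sum>i\<in>A. br z (x i))"
  by (induction A rule: infinite_finite_induct) (simp_all add: br_linear)

lemma linear_functional_comp_br:
  assumes "Vector_Spaces.linear scale (*) f"
  shows "Vector_Spaces.linear scale (*) (\<lambda>y. f (br y x))"
  using assms by (simp add: Vector_Spaces.linear_iff br_linear)

text \<open>The hypotheses collect what is used of contraction with \<open>u\<close>:
  \<open>sym\<close> is the symmetry of the tensor, \<open>inv\<close> its invariance, and
  \<open>nonzero\<close> says that the tensor does not vanish. The map \<open>\<phi>\<close> is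
  defined on all functions, whereas \<open>sym\<close> and \<open>inv\<close> concern linear
  functionals.\<close>

lemma invariant_form_if_contraction:
  fixes \<phi> :: "('l \<Rightarrow> 'f) \<Rightarrow> 'l"
  assumes simple: "simple_algebra scale br" and anti: "anticommutative br"
    and add: "\<And>f g. \<phi> (\<lambda>x. f x + g x) = \<phi> f + \<phi> g"
    and cmult: "\<And>c f. \<phi> (\<lambda>x. c * f x) = scale c (\<phi> f)"
    and sym: "\<And>f g. Vector_Spaces.linear scale (*) f \<Longrightarrow> Vector_Spaces.linear scale (*) g \<Longrightarrow>
      g (\<phi> f) = f (\<phi> g)"
    and inv: "\<And>f x. Vector_Spaces.linear scale (*) f \<Longrightarrow> br (\<phi> f) x = - \<phi> (\<lambda>y. f (br y x))"
    and nonzero: "\<exists>f. Vector_Spaces.linear scale (*) f \<and> \<phi> f \<noteq> 0"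
  shows "\<exists>\<omega>. bilinear_form scale \<omega> \<and> nondegenerate_form \<omega> \<and> symmetric_form \<omega> \<and>
    associative_form br \<omega> \<and> (\<forall>x. \<phi> (\<omega> x) = x)"
proof -
  define dual where "dual = {f :: 'l \<Rightarrow> 'f. Vector_Spaces.linear scale (*) f}"
  have dual_add: "(\<lambda>x. f x + g x) \<in> dual" and dual_cmult: "(\<lambda>x. c * f x) \<in> dual"
    if "f \<in> dual" "g \<in> dual" for f g c
    using that by (auto simp: dual_def Vector_Spaces.linear_iff algebra_simps)
  have dual_comp: "(\<lambda>y. f (br y x)) \<in> dual" if "f \<in> dual" for f x
    using that linear_functional_comp_br by (simp add: dual_def)
  obtain f0 where f0: "f0 \<in> dual" "\<phi> f0 \<noteq> 0"
    using nonzero by (auto simp: dual_def)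
  have zero: "(\<lambda>_. 0) \<in> dual" "\<phi> (\<lambda>_. 0) = 0"
    using dual_cmult[of f0 f0 0] f0 cmult[of 0] by simp_all
  have right: "br x y \<in> \<phi> ` dual" if "x \<in> \<phi> ` dual" for x y
  proof -
    from that obtain f where f: "f \<in> dual" "x = \<phi> f" by blast
    \<comment> \<open>The sign from \<open>inv\<close> is absorbed into the functional, which shows
      that the product is again a value of \<open>\<phi>\<close> on \<open>dual\<close>.\<close>
    have "br x y = \<phi> (\<lambda>z. (-1) * f (br z y))"
      using inv[of f y] cmult[of "-1" "\<lambda>z. f (br z y)"] f by (simp add: dual_def)
    then show ?thesis
      using dual_cmult[OF dual_comp[OF f(1)] f(1), of "-1" y] by blast
  qed
  have sub: "subspace (\<phi> ` dual)"
  proof (rule subspaceI)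
    show "0 \<in> \<phi> ` dual" using zero by (metis imageI)
  next
    fix x y assume "x \<in> \<phi> ` dual" "y \<in> \<phi> ` dual"
    then obtain f g where "f \<in> dual" "x = \<phi> f" "g \<in> dual" "y = \<phi> g" by blast
    then show "x + y \<in> \<phi> ` dual" by (auto simp flip: add intro!: imageI dual_add)
  next
    fix c x assume "x \<in> \<phi> ` dual"
    then obtain f where "f \<in> dual" "x = \<phi> f" by blast
    then show "scale c x \<in> \<phi> ` dual" by (auto simp flip: cmult intro!: imageI dual_cmult)
  qed
  have "br y x \<in> \<phi> ` dual" if "x \<in> \<phi> ` dual" for x y
  proof -
    have "br y x = - br x y" using anti unfolding anticommutative_def by blast
    then show ?thesis using subspace_neg[OF sub right[OF that, of y]] by simp
  qed
  then have "two_sided_ideal scale br (\<phi> ` dual)"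
    using sub right by (auto simp: two_sided_ideal_def)
  then have surj: "\<phi> ` dual = UNIV"
    using simple f0 by (auto simp: simple_algebra_def)
  \<comment> \<open>By \<open>sym\<close>, the value of \<open>f\<close> at \<open>\<phi> h\<close>
    is \<open>h (\<phi> f)\<close>, so it depends only on \<open>\<phi> f\<close>; by surjectivity
    every vector has the form \<open>\<phi> h\<close>.\<close>
  have inj: "f = g" if "f \<in> dual" "g \<in> dual" "\<phi> f = \<phi> g" for f g
  proof
    fix z
    obtain h where "h \<in> dual" "z = \<phi> h" using surj by blast
    then show "f z = g z" using sym[of h f] sym[of h g] that by (simp add: dual_def)
  qed
  have "\<forall>x. \<exists>f. f \<in> dual \<and> \<phi> f = x"
  proof
    fix x
    have "x \<in> \<phi> ` dual" by (simp add: surj)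
    then show "\<exists>f. f \<in> dual \<and> \<phi> f = x" by (auto simp: image_iff)
  qed
  from choice[OF this] obtain \<omega> where \<omega>: "\<And>x. \<omega> x \<in> dual" "\<And>x. \<phi> (\<omega> x) = x"
    by blast
  have \<omega>_sym: "\<omega> x y = \<omega> y x" for x y
    using sym[of "\<omega> y" "\<omega> x"] \<omega> by (simp add: dual_def)
  have lin: "Vector_Spaces.linear scale (*) (\<omega> x)" for x
    using \<omega>(1) by (simp add: dual_def)
  have bil: "bilinear_form scale \<omega>"
    unfolding bilinear_form_def
    using lin \<omega>_sym by presburger
  have left: "x = 0" if "\<And>y. \<omega> x y = 0" for x
  proof -
    have "\<omega> x = (\<lambda>_. 0)" using that by blast
    then show ?thesis using \<omega>(2)[of x] zero by simp
  qed
  have "x = 0" if "\<And>y. \<omega> y x = 0" for x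
    by (rule left) (simp add: \<omega>_sym[of x] that)
  with left have nondeg: "nondegenerate_form \<omega>"
    unfolding nondegenerate_form_def by blast
  \<comment> \<open>Both sides are linear functionals of \<open>y\<close> with the same image
    \<open>br z x\<close> under \<open>\<phi>\<close>, so they agree by injectivity.\<close>
  have move: "\<omega> (br z x) y = \<omega> x (br y z)" for x y z
  proof -
    have "br z x = - br x z" using anti unfolding anticommutative_def by blast
    also have "\<dots> = \<phi> (\<lambda>y. \<omega> x (br y z))"
      using inv[OF lin, of x z] \<omega>(2) by simp
    finally have "\<omega> (br z x) = (\<lambda>y. \<omega> x (br y z))"
      by (intro inj dual_comp \<omega>(1)) (simp add: \<omega>(2))
    then show ?thesis by simp
  qed
  \<comment> \<open>Two cyclic moves: by symmetry, both sides equal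
    \<open>\<omega> y (br z x)\<close>.\<close>
  have "\<omega> (br x y) z = \<omega> x (br y z)" for x y z
    using move[of x y z] move[of z x y] \<omega>_sym by metis
  then have "associative_form br \<omega>" by (simp add: associative_form_def)
  moreover have "symmetric_form \<omega>" using \<omega>_sym by (simp add: symmetric_form_def)
  ultimately show ?thesis using bil nondeg \<omega>(2) by blast
qed

end

section \<open>From the Yang-Baxter equation to the Rota-Baxter identity\<close>

theorem theorem4:
  fixes scale :: "'f::field_char_0 \<Rightarrow> 'l::ab_group_add \<Rightarrow> 'l"
    and br :: "'l \<Rightarrow> 'l \<Rightarrow> 'l"
    and a b :: "nat \<Rightarrow> 'l" and n :: nat
    and r :: "'l \<times> 'l \<Rightarrow>\<^sub>0 'f"
  assumes "nonassoc_algebra scale br"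
    and "\<exists>B. finite_dimensional_vector_space scale B"
    and "simple_algebra scale br"
    and "anticommutative br"
    and "tensor2_eq scale r (\<Sum>i<n. tens2 (a i) (b i))"
    and "\<not> skew_symmetric_tensor scale r"
    and "cybe_solution scale br r"
    and "invariant_tensor scale br (r + tensor_switch r)"
  shows "\<exists>\<omega>. bilinear_form scale \<omega> \<and> nondegenerate_form \<omega> \<and> symmetric_form \<omega> \<and>
    associative_form br \<omega> \<and>
    (\<exists>\<mu>. \<mu> \<noteq> 0 \<and> rota_baxter scale br \<mu> (\<lambda>x. \<Sum>i<n. scale (\<omega> (a i) x) (b i)))"
proof -
  interpret nonassoc_algebra scale br by fact
  obtain B where "finite_dimensional_vector_space scale B" using assms(2) by blast
  then interpret fd: finite_dimensional_vector_space scale B .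
  have anti: "br x y = - br y x" for x y
    using assms(4) unfolding anticommutative_def by blast
  \<comment> \<open>Switch, action and Yang-Baxter expression respect equality of tensors, so
    \<open>r\<close> may be replaced by this explicit representative.\<close>
  define s :: "'l \<times> 'l \<Rightarrow>\<^sub>0 'f" where "s = (\<Sum>i<n. tens2 (a i) (b i))"
  define u where "u = s + tensor_switch s"
  have rs: "tensor2_eq scale r s" using assms(5) by (simp add: s_def)
  have ru: "tensor2_eq scale (r + tensor_switch r) u"
    unfolding u_def by (intro tensor2_eq_add rs tensor_switch_respects)
  have u: "u = (\<Sum>i<n. tens2 (a i) (b i) + tens2 (b i) (a i))"
    by (simp add: u_def s_def tensor_switch_sum sum.distrib)
  define \<phi> where "\<phi> f = contract scale f u" for f
  have \<phi>: "\<phi> f = (\<Sum>i<n. scale (f (a i)) (b i) + scale (f (b i)) (a i))" for f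
    by (simp add: \<phi>_def u contract_sum contract_add)
  have \<phi>_add: "\<phi> (\<lambda>x. f x + g x) = \<phi> f + \<phi> g" for f g
    by (simp add: \<phi> scale_left_distrib sum.distrib)
  have \<phi>_cmult: "\<phi> (\<lambda>x. c * f x) = scale c (\<phi> f)" for c f
    by (simp add: \<phi> scale_right_distrib scale_sum_right)
  have lin_sum: "f (\<Sum>i<n. x i) = (\<Sum>i<n. f (x i))"
    if "Vector_Spaces.linear scale (*) f" for f x
    using that by (simp add: Vector_Spaces.linear_iff_module_hom module_hom.sum)
  have \<phi>_sym: "g (\<phi> f) = f (\<phi> g)"
    if f: "Vector_Spaces.linear scale (*) f" and g: "Vector_Spaces.linear scale (*) g" for f g
  proof -
    have "f (x + y) = f x + f y" "f (scale c x) = c * f x"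
      "g (x + y) = g x + g y" "g (scale c x) = c * g x" for x y c
      using f g by (simp_all add: Vector_Spaces.linear_iff)
    then show ?thesis
      by (simp add: \<phi> lin_sum[OF f] lin_sum[OF g] mult.commute add.commute)
  qed
  have \<phi>_inv: "br (\<phi> f) x = - \<phi> (\<lambda>y. f (br y x))"
    if f: "Vector_Spaces.linear scale (*) f" for f x
  proof -
    have "tensor2_eq scale (tensor_action br x u) 0"
      using assms(8) tensor2_eq_trans[OF tensor2_eq_sym[OF tensor_action_respects[OF assms(1) ru]]]
      by (simp add: invariant_tensor_def)
    \<comment> \<open>After contraction, the terms in which \<open>x\<close> acts on the first leg
      give \<open>\<phi>\<close> of the composed functional, and those in which it acts on the
      second leg give \<open>br (\<phi> f) x\<close>.\<close>
    from contract_respects[OF f this] have "contract scale f (tensor_action br x u) = 0"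
      by (simp add: contract_def)
    also have "tensor_action br x u = (\<Sum>i<n. tens2 (br (a i) x) (b i) + tens2 (a i) (br (b i) x)
        + (tens2 (br (b i) x) (a i) + tens2 (b i) (br (a i) x)))"
      unfolding u sum.distrib tensor_action_def lin_ext_add
      by (simp add: tensor_action_sum[unfolded tensor_action_def] sum.distrib)
    finally have "\<phi> (\<lambda>y. f (br y x)) + br (\<phi> f) x = 0"
      by (simp add: \<phi> contract_sum contract_add br_sum br_linear sum.distrib algebra_simps)
    then show ?thesis by (simp add: eq_neg_iff_add_eq_0 add.commute)
  qed
  have nonzero: "\<exists>f. Vector_Spaces.linear scale (*) f \<and> \<phi> f \<noteq> 0"
  proof (rule ccontr)
    assume "\<not> ?thesis"
    \<comment> \<open>If all contractions vanish then so does \<open>u\<close>, which makes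
      \<open>r\<close> skew-symmetric.\<close>
    then have "tensor2_eq scale u 0"
      by (intro fd.tensor2_eq_zero_if_contract_eq_zero) (auto simp: \<phi>_def)
    then have "tensor2_eq scale (r + tensor_switch r) 0"
      by (rule tensor2_eq_trans[OF ru])
    then show False
      using assms(6) by (simp add: skew_symmetric_tensor_def tensor2_eq_def add.commute)
  qed
  have "\<exists>\<omega>. bilinear_form scale \<omega> \<and> nondegenerate_form \<omega> \<and> symmetric_form \<omega> \<and>
    associative_form br \<omega> \<and> (\<forall>x. \<phi> (\<omega> x) = x)"
    by (rule invariant_form_if_contraction[where \<phi> = \<phi>, OF assms(3,4)])
      (rule \<phi>_add \<phi>_cmult \<phi>_sym \<phi>_inv nonzero | assumption)+
  then obtain \<omega> where bil: "bilinear_form scale \<omega>" and nondeg: "nondegenerate_form \<omega>"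
    and sym: "symmetric_form \<omega>" and assoc: "associative_form br \<omega>"
    and \<phi>_\<omega>: "\<And>x. \<phi> (\<omega> x) = x"
    by blast
  have lin: "Vector_Spaces.linear scale (*) (\<omega> x)" for x
    using bil by (simp add: bilinear_form_def)
  have \<omega>_sym: "\<omega> x y = \<omega> y x" for x y using sym by (simp add: symmetric_form_def)
  have \<omega>_add: "\<omega> z (x + y) = \<omega> z x + \<omega> z y" "\<omega> z (scale c x) = c * \<omega> z x" for x y z c
    using lin[of z] by (simp_all add: Vector_Spaces.linear_iff)
  have \<omega>_sum: "\<omega> z (\<Sum>i<n. x i) = (\<Sum>i<n. \<omega> z (x i))" for z x by (rule lin_sum[OF lin])
  define R where "R x = (\<Sum>i<n. scale (\<omega> (a i) x) (b i))" for x
  \<comment> \<open>The adjoint of \<open>R\<close> with respect to \<open>\<omega>\<close>: the two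
    legs exchange their roles.\<close>
  define R' where "R' x = (\<Sum>i<n. scale (\<omega> (b i) x) (a i))" for x
  have RR': "R x + R' x = x" for x
    using \<phi>_\<omega>[of x] by (simp add: \<phi> R_def R'_def sum.distrib \<omega>_sym)
  have R_add: "R (x + y) = R x + R y" and R_scale: "R (scale c x) = scale c (R x)" for x y c
    by (simp_all add: R_def \<omega>_add scale_left_distrib sum.distrib scale_sum_right)
  have R_sum: "R (\<Sum>i<n. x i) = (\<Sum>i<n. R (x i))" for x
    by (simp add: R_def \<omega>_sum scale_sum_left) (rule sum.swap)
  have cybe: "br (R x) (R y) = R (br (R x) y + br (R' y) x)" for x y
  proof -
    have "tensor3_eq scale (cybe_bilinear br s s) 0"
      using assms(7) cybe_bilinear_respects[OF assms(1) rs] free.span_diff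
      unfolding cybe_solution_def tensor3_eq_def by fastforce
    from contract3_eq_zero[OF lin[of x] lin[of y] this]
    have "(\<Sum>i<n. \<Sum>j<n. scale (\<omega> x (br (a i) (a j)) * \<omega> y (b i)) (b j)
        - scale (\<omega> x (a i) * \<omega> y (br (a j) (b i))) (b j)
        + scale (\<omega> x (a i) * \<omega> y (a j)) (br (b i) (b j))) = 0"
      by (simp add: s_def cybe_lhs_sum free_lift_sum free_lift_add free_lift_diff tens3_def)
    \<comment> \<open>Associativity isolates \<open>a j\<close> in one argument of
      \<open>\<omega>\<close>, so that summing against \<open>b j\<close> produces a value of
      \<open>R\<close>. The sign comes from anti-commutativity.\<close>
    moreover have "\<omega> x (br (a i) (a j)) = - \<omega> (a j) (br (a i) x)" for i j
    proof -
      have "\<omega> x (br (a i) (a j)) = \<omega> (a j) (br x (a i))"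
        using assoc \<omega>_sym by (metis associative_form_def)
      also have "br x (a i) = scale (-1) (br (a i) x)"
        by (subst anti) simp
      finally show ?thesis by (simp only: \<omega>_add) simp
    qed
    moreover have "\<omega> y (br (a j) (b i)) = \<omega> (a j) (br (b i) y)" for i j
      using assoc \<omega>_sym by (metis associative_form_def)
    ultimately have "(\<Sum>i<n. \<Sum>j<n. scale (\<omega> x (a i) * \<omega> y (a j)) (br (b i) (b j))) =
        (\<Sum>i<n. \<Sum>j<n. scale (\<omega> (a j) (br (a i) x) * \<omega> y (b i)) (b j))
        + (\<Sum>i<n. \<Sum>j<n. scale (\<omega> x (a i) * \<omega> (a j) (br (b i) y)) (b j))"
      by (simp add: sum.distrib sum_subtractf sum_negf algebra_simps)
    \<comment> \<open>The sum over \<open>j\<close> is \<open>R (br (a i) x)\<close>; weighting it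
      by \<open>\<omega> y (b i)\<close> and summing over \<open>i\<close> assembles
      \<open>R' y\<close> inside the product.\<close>
    also have "(\<Sum>i<n. \<Sum>j<n. scale (\<omega> (a j) (br (a i) x) * \<omega> y (b i)) (b j)) = R (br (R' y) x)"
      by (simp add: R'_def br_sum br_linear R_sum R_scale)
        (simp add: R_def scale_sum_right \<omega>_sym mult.commute)
    also have "(\<Sum>i<n. \<Sum>j<n. scale (\<omega> x (a i) * \<omega> (a j) (br (b i) y)) (b j)) = R (br (R x) y)"
      unfolding R_def[of x] br_sum br_linear R_sum R_scale
      by (simp add: R_def scale_sum_right \<omega>_sym[of x])
    also have "(\<Sum>i<n. \<Sum>j<n. scale (\<omega> x (a i) * \<omega> y (a j)) (br (b i) (b j))) = br (R x) (R y)"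
      unfolding R_def br_sum br_linear
      by (subst sum.swap)
        (simp add: scale_sum_right br_sum br_linear \<omega>_sym[of x] \<omega>_sym[of y] mult.commute)
    finally show ?thesis by (simp add: R_add add.commute)
  qed
  have "br (R x) (R y) = R (br (R x) y + br x (R y) + scale (-1) (br x y))" for x y
  proof -
    \<comment> \<open>Substituted into \<open>br (R' y) x\<close>, the part \<open>y\<close> yields
      the weight term \<open>- br x y\<close>, and the part \<open>- R y\<close> yields
      \<open>br x (R y)\<close>.\<close>
    have "R' y = y - R y" using RR'[of y] by (simp add: eq_diff_eq add.commute)
    then have "br (R' y) x = br (y - R y) x" by simp
    also have "\<dots> = br y x - br (R y) x" by (rule br_diff)
    also have "\<dots> = br x (R y) + scale (-1) (br x y)"
    proof -
      have "br y x = - br x y" "br (R y) x = - br x (R y)"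
        by (rule anti)+
      then show ?thesis by simp
    qed
    finally show ?thesis using cybe[of x y] by (simp add: add_diff_eq)
  qed
  moreover have "Vector_Spaces.linear scale scale R"
    by (simp add: Vector_Spaces.linear_iff R_add R_scale vector_space_axioms)
  ultimately have "rota_baxter scale br (-1) R" by (simp add: rota_baxter_def)
  then have "\<exists>\<mu>. \<mu> \<noteq> 0 \<and> rota_baxter scale br \<mu> (\<lambda>x. \<Sum>i<n. scale (\<omega> (a i) x) (b i))"
    by (intro exI[of _ "-1"]) (simp add: R_def[abs_def])
  then show ?thesis using bil nondeg sym assoc by blast
qed

end
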